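(* Let $R$ be a commutative associative unital ring in which $2$ is invertible, and let $n>1$ be an integer. Let $H_n(R)$ be the Jordan ring of symmetric $n\times n$ matrices over $R$ with product $a\cdot b=\frac12(ab+ba)$. Then every 2-local inner derivation on $H_n(R)$ is a derivation of the Jordan ring $H_n(R)$.
   Context: $H_n(R)=\{a\in M_n(R): a^{i,j}=a^{j,i}\text{ for all } i,j\}$, a Jordan ring under matrix addition and $a\cdot b=\frac12(ab+ba)$, where $ab$ is the ordinary matrix product. A derivation of $H_n(R)$ is a map $D:H_n(R)\to H_n(R)$ with $D(x+y)=D(x)+D(y)$ and $D(x\cdot y)=D(x)\cdot y+x\cdot D(y)$ for all $x,y$. For $a,b\in H_n(R)$ put $D_{a,b}(x)=a\cdot(b\cdot x)-b\cdot(a\cdot x)$. An inner derivation of $H_n(R)$ is a finite sum $\sum_{k=1}^m D_{a_k,b_k}$ with $a_k,b_k\in H_n(R)$. A map $\Delta:H_n(R)\to H_n(R)$ (not assumed additive) is a 2-local inner derivation if for each pair $x,y\in H_n(R)$ there is an inner derivation $D$ of $H_n(R)$ (depending on $x,y$) such that $\Delta(x)=D(x)$ and $\Delta(y)=D(y)$. *)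

theory Defs
  imports "HOL-Analysis.Analysis" "HOL-Library.FuncSet"
begin

text \<open>
  The coefficient ring is the type \<open>'a\<close>, and \<open>n\<close> is \<open>CARD('n)\<close>. Maps on the symmetric matrices
  are functions on all matrices, considered only on the carrier \<open>sym_mats\<close>.
\<close>

definition sym_mats :: "('a^'n^'n) set" where
  "sym_mats = {a. \<forall>i j. a $ i $ j = a $ j $ i}"

text \<open>Only meaningful when 2 is invertible; the inverse is then unique.\<close>

definition half :: "'a::comm_ring_1" where
  "half = (THE h. 2 * h = 1)"

definition jordan_prod ::
    "'a::comm_ring_1^'n^'n \<Rightarrow> 'a^'n^'n \<Rightarrow> 'a^'n^'n" (infixl "\<bullet>\<^sub>J" 70) where
  "a \<bullet>\<^sub>J b = map_matrix (\<lambda>r. half * r) (a ** b + b ** a)"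

definition jordan_derivation :: "('a::comm_ring_1^'n^'n \<Rightarrow> 'a^'n^'n) \<Rightarrow> bool" where
  "jordan_derivation D \<longleftrightarrow>
     D \<in> sym_mats \<rightarrow> sym_mats \<and>
     (\<forall>x\<in>sym_mats. \<forall>y\<in>sym_mats. D (x + y) = D x + D y) \<and>
     (\<forall>x\<in>sym_mats. \<forall>y\<in>sym_mats. D (x \<bullet>\<^sub>J y) = D x \<bullet>\<^sub>J y + x \<bullet>\<^sub>J D y)"

definition jordan_comm ::
    "'a::comm_ring_1^'n^'n \<Rightarrow> 'a^'n^'n \<Rightarrow> 'a^'n^'n \<Rightarrow> 'a^'n^'n" where
  "jordan_comm a b x = a \<bullet>\<^sub>J (b \<bullet>\<^sub>J x) - b \<bullet>\<^sub>J (a \<bullet>\<^sub>J x)"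

definition inner_derivation :: "('a::comm_ring_1^'n^'n \<Rightarrow> 'a^'n^'n) \<Rightarrow> bool" where
  "inner_derivation D \<longleftrightarrow>
     (\<exists>(m::nat) a b. a \<in> {1..m} \<rightarrow> sym_mats \<and> b \<in> {1..m} \<rightarrow> sym_mats \<and>
        (\<forall>x\<in>sym_mats. D x = (\<Sum>k=1..m. jordan_comm (a k) (b k) x)))"

definition two_local_inner_derivation :: "('a::comm_ring_1^'n^'n \<Rightarrow> 'a^'n^'n) \<Rightarrow> bool" where
  "two_local_inner_derivation \<Delta> \<longleftrightarrow>
     \<Delta> \<in> sym_mats \<rightarrow> sym_mats \<and>
     (\<forall>x\<in>sym_mats. \<forall>y\<in>sym_mats. \<exists>D. inner_derivation D \<and> \<Delta> x = D x \<and> \<Delta> y = D y)"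

end

theory Submission
  imports Defs
begin

text \<open>
  On symmetric matrices an inner derivation is a commutator \<open>x \<mapsto> Sx - xS\<close>, so it is skew with
  respect to the trace form: \<open>tr (D(x) y) = - tr (x D(y))\<close>. This identity involves only two points,
  hence it passes to a 2-local inner derivation \<open>\<Delta>\<close>; its right-hand side is additive in \<open>x\<close>, and the
  trace form is nondegenerate on symmetric matrices because 2 is invertible, so \<open>\<Delta>\<close> is additive.
  Applying 2-locality to \<open>x\<close> and \<open>x\<^sup>2\<close> gives the Leibniz rule for squares, which is then polarized.
\<close>

section \<open>Inverting and cancelling 2\<close>

lemma half_mult_two:
  assumes "(2::'a::comm_ring_1) dvd 1"
  shows "2 * (half::'a) = 1"
proof -
  obtain k :: 'a where k: "2 * k = 1"
    using assms by (auto elim!: dvdE)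
  \<comment> \<open>Uniqueness of the inverse of 2, so that the description in \<open>half\<close>
    denotes \<open>k\<close>.\<close>
  have "h = k" if "2 * h = 1" for h :: 'a
  proof -
    have "h = h * (2 * k)"
      by (simp add: k)
    also have "\<dots> = (2 * h) * k"
      by (simp only: ac_simps)
    finally show ?thesis
      by (simp add: that)
  qed
  with k have "(THE h::'a. 2 * h = 1) = k"
    by blast
  with k show ?thesis
    by (simp add: half_def)
qed

lemma double_eq_cancel:
  assumes "(2::'a::comm_ring_1) dvd 1" and "r + r = s + (s::'a)"
  shows "r = s"
proof -
  have "half * (2 * r) = half * (2 * s)"
    using assms(2) by (simp only: mult_2)
  then have "(2 * half) * r = (2 * half) * s"
    by (simp only: ac_simps)
  then show ?thesis
    by (simp add: half_mult_two[OF assms(1)])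
qed

lemma matrix_double_eq_cancel:
  fixes A B :: "'a::comm_ring_1^'n^'m"
  assumes "(2::'a) dvd 1" and "A + A = B + B"
  shows "A = B"
proof -
  have "A $ i $ j = B $ i $ j" for i j
    using double_eq_cancel[OF assms(1)] assms(2) by (metis vector_add_component)
  then show ?thesis
    by (simp add: vec_eq_iff)
qed

section \<open>Matrix arithmetic and the Jordan product\<close>

lemma matrix_add_rdistrib: "(A + B) ** C = A ** C + B ** C"
  for A B :: "'a::semiring_1^'n^'m" and C :: "'a^'k^'n"
  by (simp add: vec_eq_iff matrix_matrix_mult_def sum.distrib distrib_right)

lemma matrix_diff_ldistrib: "A ** (B - C) = A ** B - A ** C"
  for A :: "'a::ring_1^'n^'m" and B C :: "'a^'k^'n"
  by (simp add: vec_eq_iff matrix_matrix_mult_def sum_subtractf right_diff_distrib)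

lemma matrix_diff_rdistrib: "(A - B) ** C = A ** C - B ** C"
  for A B :: "'a::ring_1^'n^'m" and C :: "'a^'k^'n"
  by (simp add: vec_eq_iff matrix_matrix_mult_def sum_subtractf left_diff_distrib)

text \<open>Entrywise scaling becomes multiplication by a central matrix, so the factors
  \<open>half\<close> can be moved by the laws of \<open>**\<close>.\<close>

lemma map_matrix_mult_eq_mat: "map_matrix (\<lambda>r. c * r) A = mat c ** A"
  for A :: "'a::comm_ring_1^'n^'n"
proof -
  have "(mat c ** A) $ i $ j = c * A $ i $ j" for i j
  proof -
    have "(mat c ** A) $ i $ j = (\<Sum>k\<in>UNIV. if i = k then c * A $ k $ j else 0)"
      unfolding matrix_matrix_mult_def mat_def vec_lambda_beta by (intro sum.cong) auto
    then show ?thesis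
      by simp
  qed
  then show ?thesis
    by (simp add: vec_eq_iff)
qed

lemma mat_matrix_commute: "A ** mat c = mat c ** A"
  for A :: "'a::comm_ring_1^'n^'n"
proof -
  have "(A ** mat c) $ i $ j = c * A $ i $ j" for i j
  proof -
    have "(A ** mat c) $ i $ j = (\<Sum>k\<in>UNIV. if k = j then c * A $ i $ k else 0)"
      unfolding matrix_matrix_mult_def mat_def vec_lambda_beta by (intro sum.cong) auto
    then show ?thesis
      by simp
  qed
  then show ?thesis
    unfolding map_matrix_mult_eq_mat[symmetric] by (simp add: vec_eq_iff)
qed

lemma mat_matrix_left_commute: "A ** (mat c ** B) = mat c ** (A ** B)"
  for A B :: "'a::comm_ring_1^'n^'n"
  by (metis mat_matrix_commute matrix_mul_assoc)

text \<open>Doubling clears \<open>half\<close>; Jordan identities then reduce to identities between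
  ordinary products, up to cancelling 2.\<close>

lemma jordan_prod_double:
  fixes a b :: "'a::comm_ring_1^'n^'n"
  assumes "(2::'a) dvd 1"
  shows "a \<bullet>\<^sub>J b + a \<bullet>\<^sub>J b = a ** b + b ** a"
proof -
  have half: "half * r + half * r = r" for r :: 'a
    using half_mult_two[OF assms] by (metis distrib_right mult_1 mult_2)
  show ?thesis
    by (simp only: jordan_prod_def vec_eq_iff vector_add_component nth_map_matrix half) simp
qed

lemma jordan_prod_mat: "a \<bullet>\<^sub>J b = mat half ** (a ** b + b ** a)"
  by (simp add: jordan_prod_def map_matrix_mult_eq_mat)

section \<open>Closure properties of the symmetric matrices\<close>

lemma sym_mats_iff: "a \<in> sym_mats \<longleftrightarrow> transpose a = a"
  by (auto simp: sym_mats_def transpose_def vec_eq_iff)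

lemma sym_mats_add: "a + b \<in> sym_mats" if "a \<in> sym_mats" "b \<in> sym_mats"
  for a b :: "'a::comm_ring_1^'n^'n"
  using that by (simp add: sym_mats_def)

lemma sym_mats_diff: "a - b \<in> sym_mats" if "a \<in> sym_mats" "b \<in> sym_mats"
  for a b :: "'a::comm_ring_1^'n^'n"
  using that by (simp add: sym_mats_def)

lemma sym_mats_jordan_prod: "a \<bullet>\<^sub>J b \<in> sym_mats" if "a \<in> sym_mats" "b \<in> sym_mats"
  for a b :: "'a::comm_ring_1^'n^'n"
proof -
  have "transpose (a ** b + b ** a) = transpose (a ** b) + transpose (b ** a)"
    by (simp add: transpose_def vec_eq_iff)
  also have "\<dots> = a ** b + b ** a"
    using that by (simp add: matrix_transpose_mul sym_mats_iff add.commute)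
  finally have "a ** b + b ** a \<in> sym_mats"
    by (simp add: sym_mats_iff)
  then show ?thesis
    by (simp add: jordan_prod_def sym_mats_def map_matrix_def)
qed

lemma sym_mats_square: "a ** a \<in> sym_mats" if "a \<in> sym_mats"
  for a :: "'a::comm_ring_1^'n^'n"
  using that by (simp add: sym_mats_iff matrix_transpose_mul)

section \<open>Inner derivations as commutators\<close>

lemma jordan_comm_commutator:
  fixes a b x :: "'a::comm_ring_1^'n^'n"
  defines "S \<equiv> mat half ** (mat half ** (a ** b - b ** a))"
  shows "jordan_comm a b x = S ** x - x ** S"
proof -
  let ?M = "mat half :: 'a^'n^'n"
  let ?C = "a ** b - b ** a"
  have pull: "u ** (?M ** w) + (?M ** w) ** u = ?M ** (u ** w + w ** u)" for u w :: "'a^'n^'n"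
    by (simp only: mat_matrix_left_commute matrix_mul_assoc[symmetric] matrix_add_ldistrib)
  \<comment> \<open>Left and right multiplications commute, so the mixed terms
    \<open>a ** x ** b\<close> and \<open>b ** x ** a\<close> cancel. What remains is the commutator
    with \<open>?C\<close>, and the two nested Jordan products contribute one factor
    \<open>half\<close> each.\<close>
  have "(a ** (b ** x + x ** b) + (b ** x + x ** b) ** a) -
      (b ** (a ** x + x ** a) + (a ** x + x ** a) ** b) = ?C ** x - x ** ?C"
    by (simp add: matrix_add_ldistrib matrix_add_rdistrib matrix_diff_ldistrib matrix_diff_rdistrib
        matrix_mul_assoc)
  then have "jordan_comm a b x = ?M ** (?M ** (?C ** x - x ** ?C))"
    unfolding jordan_comm_def jordan_prod_mat pull matrix_diff_ldistrib[of ?M, symmetric]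
    by (rule arg_cong)
  also have "\<dots> = S ** x - x ** S"
    unfolding S_def
    by (simp only: matrix_diff_ldistrib[of ?M _ "x ** ?C"]
        matrix_diff_ldistrib[of ?M _ "?M ** (x ** ?C)"] mat_matrix_left_commute[of x]
        matrix_mul_assoc[symmetric])
  finally show ?thesis .
qed

text \<open>The commutator with \<open>x\<close> is additive in its other argument, so the matrices
  of the summands add up to a single \<open>S\<close>; the empty sum gives 0.\<close>

lemma inner_derivation_commutator:
  fixes D :: "'a::comm_ring_1^'n^'n \<Rightarrow> 'a^'n^'n"
  assumes "inner_derivation D"
  obtains S where "\<And>x. x \<in> sym_mats \<Longrightarrow> D x = S ** x - x ** S"
proof -
  obtain m :: nat and a b where D: "\<And>x. x \<in> sym_mats \<Longrightarrow> D x = (\<Sum>k=1..m. jordan_comm (a k) (b k) x)"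
    using assms unfolding inner_derivation_def by blast
  have "\<exists>S. \<forall>x. (\<Sum>k=1..m. jordan_comm (a k) (b k) x) = S ** x - x ** S"
  proof (induction m)
    case 0
    show ?case
      by (intro exI[of _ 0]) (simp add: matrix_matrix_mult_def vec_eq_iff)
  next
    case (Suc m)
    then obtain S where "\<forall>x. (\<Sum>k=1..m. jordan_comm (a k) (b k) x) = S ** x - x ** S"
      by blast
    moreover obtain T where "\<forall>x. jordan_comm (a (Suc m)) (b (Suc m)) x = T ** x - x ** T"
      using jordan_comm_commutator by blast
    ultimately show ?case
      by (intro exI[of _ "S + T"]) (simp add: matrix_add_ldistrib matrix_add_rdistrib)
  qed
  with D that show ?thesis
    by metis
qed

text \<open>What matters is that the same \<open>S\<close> serves both points; it may change with
  the pair.\<close>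

lemma two_local_inner_derivation_commutator:
  fixes \<Delta> :: "'a::comm_ring_1^'n^'n \<Rightarrow> 'a^'n^'n"
  assumes "two_local_inner_derivation \<Delta>" "x \<in> sym_mats" "y \<in> sym_mats"
  obtains S where "\<Delta> x = S ** x - x ** S" "\<Delta> y = S ** y - y ** S"
proof -
  obtain D where "inner_derivation D" "\<Delta> x = D x" "\<Delta> y = D y"
    using assms unfolding two_local_inner_derivation_def by blast
  with assms(2,3) that show ?thesis
    by (metis inner_derivation_commutator)
qed

section \<open>The trace form and additivity\<close>

lemma trace_two_local_skew:
  fixes \<Delta> :: "'a::comm_ring_1^'n^'n \<Rightarrow> 'a^'n^'n"
  assumes "two_local_inner_derivation \<Delta>" "x \<in> sym_mats" "y \<in> sym_mats"
  shows "trace (\<Delta> x ** y) = - trace (x ** \<Delta> y)"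
proof -
  obtain S where S: "\<Delta> x = S ** x - x ** S" "\<Delta> y = S ** y - y ** S"
    using two_local_inner_derivation_commutator[OF assms] .
  \<comment> \<open>The terms \<open>trace (x ** S ** y)\<close> cancel because \<open>S\<close> is
    shared; cyclicity of the trace matches the other two.\<close>
  have "trace (S ** x ** y) = trace (x ** y ** S)"
    by (metis trace_mul_sym matrix_mul_assoc)
  then show ?thesis
    by (simp add: S matrix_diff_ldistrib matrix_diff_rdistrib trace_sub matrix_mul_assoc)
qed

lemma trace_form_nondegenerate:
  fixes z :: "'a::comm_ring_1^'n^'n"
  assumes two: "(2::'a) dvd 1" and z: "z \<in> sym_mats"
    and orth: "\<And>y. y \<in> sym_mats \<Longrightarrow> trace (z ** y) = 0"
  shows "z = 0"
proof -
  have "z $ p $ q = 0" for p q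
  proof -
    let ?e = "\<lambda>p q. (\<chi> i j. if i = p then if j = q then 1 else 0 else 0) :: 'a^'n^'n"
    have tr: "trace (z ** ?e p q) = z $ q $ p" for p q
      by (simp add: trace_def matrix_matrix_mult_def if_distrib[of "\<lambda>r. _ * r"]
          cong: if_cong)
    \<comment> \<open>Test matrices must be symmetric, so the matrix unit is symmetrized. Since
      \<open>z\<close> is symmetric, this yields twice the entry of \<open>z\<close>, also when
      \<open>p = q\<close>.\<close>
    have "?e p q + ?e q p \<in> sym_mats"
      by (simp add: sym_mats_def)
    then have "z $ q $ p + z $ p $ q = 0"
      using orth[of "?e p q + ?e q p"] by (simp add: matrix_add_ldistrib trace_add tr)
    moreover have "z $ q $ p = z $ p $ q"
      using z by (simp add: sym_mats_def)
    ultimately show ?thesis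
      using double_eq_cancel[OF two, of "z $ p $ q" 0] by simp
  qed
  then show ?thesis
    by (simp add: vec_eq_iff)
qed

lemma two_local_inner_derivation_add:
  fixes \<Delta> :: "'a::comm_ring_1^'n^'n \<Rightarrow> 'a^'n^'n"
  assumes two: "(2::'a) dvd 1" and loc: "two_local_inner_derivation \<Delta>"
    and xy: "x \<in> sym_mats" "y \<in> sym_mats"
  shows "\<Delta> (x + y) = \<Delta> x + \<Delta> y"
proof -
  have in_sym: "\<Delta> u \<in> sym_mats" if "u \<in> sym_mats" for u
    using loc that by (auto simp: two_local_inner_derivation_def)
  have "\<Delta> (x + y) - \<Delta> x - \<Delta> y = 0"
  proof (rule trace_form_nondegenerate[OF two])
    show "\<Delta> (x + y) - \<Delta> x - \<Delta> y \<in> sym_mats"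
      using xy by (intro sym_mats_diff in_sym sym_mats_add)
    \<comment> \<open>Skewness moves \<open>\<Delta>\<close> onto \<open>w\<close>, leaving
      \<open>x + y\<close>, \<open>x\<close> and \<open>y\<close> in an expression linear in
      them.\<close>
    show "trace ((\<Delta> (x + y) - \<Delta> x - \<Delta> y) ** w) = 0" if "w \<in> sym_mats" for w
      using xy that trace_two_local_skew[OF loc]
      by (simp add: matrix_diff_rdistrib trace_sub sym_mats_add matrix_add_rdistrib trace_add)
  qed
  then show ?thesis
    by (simp add: algebra_simps)
qed

section \<open>The Leibniz rule\<close>

lemma two_local_inner_derivation_square:
  fixes \<Delta> :: "'a::comm_ring_1^'n^'n \<Rightarrow> 'a^'n^'n"
  assumes "two_local_inner_derivation \<Delta>" "x \<in> sym_mats"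
  shows "\<Delta> (x ** x) = \<Delta> x ** x + x ** \<Delta> x"
proof -
  \<comment> \<open>With one \<open>S\<close> for \<open>x\<close> and its square, the terms
    \<open>x ** S ** x\<close> in the product rule cancel.\<close>
  obtain S where "\<Delta> x = S ** x - x ** S" "\<Delta> (x ** x) = S ** (x ** x) - (x ** x) ** S"
    using two_local_inner_derivation_commutator[OF assms sym_mats_square[OF assms(2)]] .
  then show ?thesis
    by (simp add: matrix_diff_ldistrib matrix_diff_rdistrib matrix_mul_assoc)
qed

theorem theorem5p7:
  fixes \<Delta> :: "'a::comm_ring_1^'n^'n \<Rightarrow> 'a^'n^'n"
  assumes "(2::'a) dvd 1"
    and "CARD('n) > 1"
    and "two_local_inner_derivation \<Delta>"
  shows "jordan_derivation \<Delta>"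
proof -
  note add = two_local_inner_derivation_add[OF assms(1,3)]
  note square = two_local_inner_derivation_square[OF assms(3)]
  note double = jordan_prod_double[OF assms(1)]
  have "\<Delta> (x \<bullet>\<^sub>J y) = \<Delta> x \<bullet>\<^sub>J y + x \<bullet>\<^sub>J \<Delta> y" if xy: "x \<in> sym_mats" "y \<in> sym_mats" for x y
  proof (rule matrix_double_eq_cancel[OF assms(1)])
    let ?p = "x \<bullet>\<^sub>J y"
    \<comment> \<open>The cross terms are grouped as \<open>?p + ?p\<close> because
      \<open>x ** y\<close> alone need not be symmetric, while additivity of \<open>\<Delta>\<close>
      is known only on \<open>sym_mats\<close>.\<close>
    have "(x + y) ** (x + y) = x ** x + y ** y + (?p + ?p)"
      by (simp add: double matrix_add_ldistrib matrix_add_rdistrib)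
    then have "\<Delta> ((x + y) ** (x + y)) = \<Delta> (x ** x) + \<Delta> (y ** y) + (\<Delta> ?p + \<Delta> ?p)"
      using xy by (simp only: add sym_mats_add sym_mats_square sym_mats_jordan_prod)
    moreover have "\<Delta> ((x + y) ** (x + y)) = (\<Delta> x + \<Delta> y) ** (x + y) + (x + y) ** (\<Delta> x + \<Delta> y)"
      using xy by (simp only: square add sym_mats_add)
    \<comment> \<open>Comparing both expansions, the square rule at \<open>x\<close> and at
      \<open>y\<close> removes the pure terms.\<close>
    ultimately have "\<Delta> ?p + \<Delta> ?p = (\<Delta> x ** y + y ** \<Delta> x) + (x ** \<Delta> y + \<Delta> y ** x)"
      using xy by (simp add: square matrix_add_ldistrib matrix_add_rdistrib algebra_simps)
    also have "\<dots> = (\<Delta> x \<bullet>\<^sub>J y + \<Delta> x \<bullet>\<^sub>J y) + (x \<bullet>\<^sub>J \<Delta> y + x \<bullet>\<^sub>J \<Delta> y)"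
      by (simp add: double)
    finally show "\<Delta> ?p + \<Delta> ?p = (\<Delta> x \<bullet>\<^sub>J y + x \<bullet>\<^sub>J \<Delta> y) + (\<Delta> x \<bullet>\<^sub>J y + x \<bullet>\<^sub>J \<Delta> y)"
      by (simp add: algebra_simps)
  qed
  with add assms(3) show ?thesis
    by (simp add: jordan_derivation_def two_local_inner_derivation_def)
qed

end
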